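(* Let $\mathcal{X}$ be a finite dimensional real inner product space, $f:\mathcal{X}\to\mathbb{R}$ and $g:\mathcal{X}\to\mathbb{R}^{m\times n}$ continuously differentiable, $1\le k\le m\le n$, and $\theta=\|\cdot\|_{(k)}$ the Ky Fan $k$-norm. Let $\bar x\in\mathcal{X}$ be a locally optimal solution of $\min\{f(x)+\theta(g(x))\mid x\in\mathcal{X}\}$ and put $\overline X=g(\bar x)$. If $\bar x$ is nondegenerate, then the $\overline S\in\mathbb{R}^{m\times n}$ satisfying $$\nabla f(\bar x)+g'(\bar x)^*\overline S=0,\qquad \overline S\in\partial\theta(\overline X)$$ is unique. Conversely, if $\overline S$ satisfying these conditions is unique and the strict complementarity condition holds at $\bar x$, then $\bar x$ is nondegenerate.
   Context: $\mathbb{R}^{m\times n}$ carries the inner product $\langle Y,Z\rangle=\mathrm{Tr}(Y^TZ)$; $\|Z\|_{(k)}$ is the sum of the $k$ largest singular values of $Z$. $g'(\bar x)^*$ is the adjoint of the derivative $g'(\bar x)$; $\partial\theta$ is the convex subdifferential; $\theta'(\overline X;H)$ is the directional derivative; $\mathrm{ri}$ denotes relative interior. Nondegeneracy: $\bar x$ is nondegenerate if $g'(\bar x)\mathcal{X}+\mathcal{T}^{\mathrm{lin}}(\overline X)=\mathbb{R}^{m\times n}$, where $\mathcal{T}^{\mathrm{lin}}(\overline X)=\{H\in\mathbb{R}^{m\times n}\mid\theta'(\overline X;H)=-\theta'(\overline X;-H)\}$ (a linear subspace). Strict complementarity: the strict complementarity condition holds at $\bar x$ if there exists $\overline S\in\mathrm{ri}(\partial\theta(\overline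 X))$ with $\nabla f(\bar x)+g'(\bar x)^*\overline S=0$. *)

theory Defs
  imports "HOL-Analysis.Analysis" "HOL-Computational_Algebra.Polynomial" "HOL-Library.Multiset"
begin

text \<open>
  Matrices in $R^{m \times n}$ are elements of \<open>real^'n^'m\<close>.  The library inner product on this
  type is the trace inner product.
\<close>

lemma inner_matrix_eq_trace:
  fixes Y Z :: "real^'n^'m"
  shows "Y \<bullet> Z = trace (transpose Y ** Z)"
proof -
  have "Y \<bullet> Z = (\<Sum>i\<in>UNIV. \<Sum>j\<in>UNIV. Y $ i $ j * Z $ i $ j)"
    by (simp add: inner_vec_def)
  also have "\<dots> = (\<Sum>j\<in>UNIV. \<Sum>i\<in>UNIV. Y $ i $ j * Z $ i $ j)"
    by (rule sum.swap)
  finally show ?thesis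
    by (simp add: trace_def transpose_def matrix_matrix_mult_def)
qed

definition charpoly :: "real^'m^'m \<Rightarrow> real poly" where
  "charpoly A = det (\<chi> i j. (if i = j then [:0, 1:] else 0) - [:A $ i $ j:])"

text \<open>
  The square roots of the eigenvalues of $Z Z^T$, repeated according to multiplicity, in
  nonincreasing order.  As $Z Z^T$ is symmetric, all roots of its characteristic polynomial are
  real, so the list has length \<open>CARD('m)\<close>; these are the usual $\min(m,n)$ singular values
  of \<open>Z\<close> provided that $m \le n$.
\<close>

definition singular_values :: "real^'n^'m \<Rightarrow> real list" where
  "singular_values Z =
     rev (sorted_list_of_multiset (image_mset sqrt (proots (charpoly (Z ** transpose Z)))))"

definition ky_fan_norm :: "nat \<Rightarrow> real^'n^'m \<Rightarrow> real" where
  "ky_fan_norm k Z = sum_list (take k (singular_values Z))"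

definition continuously_differentiable ::
    "('a::real_normed_vector \<Rightarrow> 'b::real_normed_vector) \<Rightarrow> bool" where
  "continuously_differentiable f \<longleftrightarrow>
     (\<exists>f' :: 'a \<Rightarrow> 'a \<Rightarrow>\<^sub>L 'b.
        (\<forall>x. (f has_derivative blinfun_apply (f' x)) (at x)) \<and> continuous_on UNIV f')"

definition gradient :: "('a::real_inner \<Rightarrow> real) \<Rightarrow> 'a \<Rightarrow> 'a" where
  "gradient f x = (THE D. GDERIV f x :> D)"

definition dir_deriv :: "('a::real_normed_vector \<Rightarrow> real) \<Rightarrow> 'a \<Rightarrow> 'a \<Rightarrow> real" where
  "dir_deriv \<theta> X H = Lim (at_right 0) (\<lambda>t. (\<theta> (X + t *\<^sub>R H) - \<theta> X) / t)"

definition subdifferential :: "('a::real_inner \<Rightarrow> real) \<Rightarrow> 'a \<Rightarrow> 'a set" where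
  "subdifferential \<theta> X = {S. \<forall>Z. \<theta> Z \<ge> \<theta> X + S \<bullet> (Z - X)}"

definition local_minimizer :: "('a::topological_space \<Rightarrow> real) \<Rightarrow> 'a \<Rightarrow> bool" where
  "local_minimizer F x \<longleftrightarrow> (\<forall>\<^sub>F y in nhds x. F x \<le> F y)"

definition T_lin :: "('b::real_normed_vector \<Rightarrow> real) \<Rightarrow> 'b \<Rightarrow> 'b set" where
  "T_lin \<theta> X = {H. dir_deriv \<theta> X H = - dir_deriv \<theta> X (- H)}"

definition nondegenerate ::
    "('b::real_normed_vector \<Rightarrow> real) \<Rightarrow> ('a::real_normed_vector \<Rightarrow> 'b) \<Rightarrow> 'a \<Rightarrow> bool" where
  "nondegenerate \<theta> g x \<longleftrightarrow>
     {U + H | U H. U \<in> range (frechet_derivative g (at x)) \<and> H \<in> T_lin \<theta> (g x)} = UNIV"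

definition stationarity ::
    "('a::real_inner \<Rightarrow> real) \<Rightarrow> ('a \<Rightarrow> 'b::real_inner) \<Rightarrow> 'a \<Rightarrow> 'b \<Rightarrow> bool" where
  "stationarity f g x S \<longleftrightarrow> gradient f x + adjoint (frechet_derivative g (at x)) S = 0"

definition strict_complementarity ::
    "('b::euclidean_space \<Rightarrow> real) \<Rightarrow> ('a::real_inner \<Rightarrow> real) \<Rightarrow> ('a \<Rightarrow> 'b) \<Rightarrow> 'a \<Rightarrow> bool" where
  "strict_complementarity \<theta> f g x \<longleftrightarrow>
     (\<exists>S \<in> rel_interior (subdifferential \<theta> (g x)). stationarity f g x S)"

end

theory Submission
  imports Defs
begin

text \<open>
  The statement is convex duality for an arbitrary finite convex function \<open>\<theta>\<close> on a Euclidean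
  space; the only fact about the Ky Fan norm that enters is its convexity.

  \<^emph>\<open>Convexity.\<close>  The characteristic polynomial of $Z Z^T$ is the product of the linear factors
  of its eigenvalues, by the spectral theorem, so \<open>ky_fan_norm k Z\<close> is the sum of the $k$ largest
  singular values in the usual sense.  Ky Fan's variational principle writes that sum as the
  maximum of $\sum_{j \in I} \langle u_j, Z v_j\rangle$ over families of $k$ vectors that
  are pairwise orthogonal and have norm at most one (\<open>ky_fan_norm_upper_bound\<close>,
  \<open>ky_fan_norm_attained\<close>).  A maximum of linear functions of $Z$ is convex.

  \<^emph>\<open>Directional derivative.\<close>  For convex \<open>\<theta>\<close> the map \<open>H \<mapsto> dir_deriv \<theta> X H\<close> is sublinear and is the
  support function of the subdifferential; the maximum is attained by a Hahn-Banach
  extension (\<open>subgradient_extending_functional\<close>, \<open>dir_deriv_attained\<close>).  Therefore a direction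
  lies in \<open>T_lin \<theta> X\<close> exactly if all subgradients have the same inner product with it
  (\<open>T_lin_iff\<close>): \<open>T_lin \<theta> X\<close> is the orthogonal complement of the differences of subgradients.

  \<^emph>\<open>Existence.\<close>  At a local minimizer $f'(h) + \theta'(g(x); g'(x) h) \ge 0$ for all $h$.  Hence
  $-f'$ factors through $g'(x)$ as a linear functional on its range that is dominated by the
  directional derivative, and any dominated extension of it is a multiplier.

  \<^emph>\<open>Uniqueness.\<close>  The difference of two multipliers is orthogonal to the range of $g'(x)$ by
  stationarity and to \<open>T_lin\<close> because both are subgradients; under nondegeneracy these two
  spaces span everything.

  \<^emph>\<open>Converse.\<close>  If nondegeneracy fails, some $W \ne 0$ is orthogonal to both spaces.
  Orthogonality to \<open>T_lin\<close> puts $W$ into the direction space of the affine hull of the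
  subdifferential, so a multiplier in the relative interior can be moved along $W$ without
  leaving the subdifferential, and orthogonality to the range of $g'(x)$ keeps it stationary.
  This contradicts uniqueness.
\<close>

section \<open>The spectral theorem for real symmetric matrices\<close>

lemma nonneg_quadratic_imp_linear_coeff_zero:
  fixes b c :: real
  assumes "\<And>t. 0 \<le> 2 * t * b + t\<^sup>2 * c"
  shows "b = 0"
proof (rule ccontr)
  assume "b \<noteq> 0"
  \<comment> \<open>the minimizer of the quadratic if c is replaced by a positive upper bound\<close>
  define t where "t = - b / (\<bar>c\<bar> + 1)"
  have "2 * t * b + t\<^sup>2 * c \<le> 2 * t * b + t\<^sup>2 * (\<bar>c\<bar> + 1)"
    by (intro add_left_mono mult_left_mono) auto
  also have "\<dots> = - b\<^sup>2 / (\<bar>c\<bar> + 1)"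
    by (simp add: t_def power2_eq_square divide_simps)
  also have "\<dots> < 0"
    using \<open>b \<noteq> 0\<close> by (simp add: divide_less_0_iff)
  finally show False
    using assms[of t] by simp
qed

text \<open>
  The Rayleigh quotient attains its maximum \<open>c\<close> on the unit sphere of \<open>S\<close> at some \<open>e\<close>.  The
  quadratic form \<open>c * (x \<bullet> x) - T x \<bullet> x\<close> is nonnegative on \<open>S\<close> and vanishes at \<open>e\<close>, so its
  first-order variation at \<open>e\<close> vanishes in all directions of \<open>S\<close>, which is the eigenvector equation.
\<close>

lemma selfadjoint_has_eigenvector:
  fixes T :: "'a::euclidean_space \<Rightarrow> 'a"
  assumes lin: "linear T" and sa: "\<And>x y. T x \<bullet> y = x \<bullet> T y"
    and S: "subspace S" "S \<noteq> {0}" and inv: "\<And>x. x \<in> S \<Longrightarrow> T x \<in> S"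
  obtains e c where "e \<in> S" "norm e = 1" "T e = c *\<^sub>R e"
proof -
  let ?K = "S \<inter> sphere 0 1"
  interpret T: linear T by (rule lin)
  obtain s where s: "s \<in> S" "s \<noteq> 0"
    using S subspace_0 by blast
  then have "s /\<^sub>R norm s \<in> ?K"
    using S by (auto simp: subspace_scale)
  moreover have "compact ?K"
    using S by (intro closed_Int_compact closed_subspace) auto
  moreover have "continuous_on ?K (\<lambda>x. T x \<bullet> x)"
    using lin by (intro continuous_intros linear_continuous_on linear_conv_bounded_linear[THEN iffD1])
  ultimately obtain e where e: "e \<in> ?K" and max: "\<And>x. x \<in> ?K \<Longrightarrow> T x \<bullet> x \<le> T e \<bullet> e"
    using continuous_attains_sup[of ?K "\<lambda>x. T x \<bullet> x"] by (metis empty_iff)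
  define c where "c = T e \<bullet> e"
  have ee: "e \<bullet> e = 1"
    using e by (simp add: norm_eq_1)
  have nonneg: "0 \<le> c * (x \<bullet> x) - T x \<bullet> x" if "x \<in> S" for x
  proof (cases "x = 0")
    case False
    have "x /\<^sub>R norm x \<in> ?K"
      using that False S by (auto simp: subspace_scale)
    from max[OF this] have "T x \<bullet> x / (norm x * norm x) \<le> c"
      by (simp add: c_def T.scaleR divide_inverse mult_ac)
    then show ?thesis
      using False by (simp add: dot_square_norm power2_eq_square divide_le_eq split: if_splits)
  qed simp
  have "(c *\<^sub>R e - T e) \<bullet> y = 0" if "y \<in> S" for y
  proof (rule nonneg_quadratic_imp_linear_coeff_zero)
    fix t :: real
    have "e + t *\<^sub>R y \<in> S"
      using that e S by (auto simp: subspace_add subspace_scale)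
    then have "0 \<le> c * ((e + t *\<^sub>R y) \<bullet> (e + t *\<^sub>R y)) - T (e + t *\<^sub>R y) \<bullet> (e + t *\<^sub>R y)"
      by (rule nonneg)
    also have "T (e + t *\<^sub>R y) \<bullet> (e + t *\<^sub>R y) = c + 2 * t * (T e \<bullet> y) + t\<^sup>2 * (T y \<bullet> y)"
    proof -
      have "T y \<bullet> e = T e \<bullet> y"
        using sa[of y e] by (simp add: inner_commute)
      then show ?thesis
        by (simp add: T.add T.scaleR inner_add_left inner_add_right c_def power2_eq_square distrib_left)
    qed
    also have "(e + t *\<^sub>R y) \<bullet> (e + t *\<^sub>R y) = 1 + 2 * t * (e \<bullet> y) + t\<^sup>2 * (y \<bullet> y)"
      using inner_commute[of y e]
      by (simp add: inner_add_left inner_add_right power2_eq_square ee distrib_left)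
    finally show "0 \<le> 2 * t * ((c *\<^sub>R e - T e) \<bullet> y) + t\<^sup>2 * (c * (y \<bullet> y) - T y \<bullet> y)"
      by (simp add: inner_diff_left algebra_simps)
  qed
  moreover have "c *\<^sub>R e - T e \<in> S"
    using e S inv by (auto simp: subspace_diff subspace_scale)
  ultimately have "T e = c *\<^sub>R e"
    by (metis inner_eq_zero_iff right_minus_eq)
  then show ?thesis
    using that e by auto
qed

text \<open>
  Induction on the dimension of \<open>S\<close>: the orthogonal complement in \<open>S\<close> of one eigenvector is again
  invariant, by self-adjointness.
\<close>

lemma selfadjoint_orthonormal_eigenbasis:
  fixes T :: "'a::euclidean_space \<Rightarrow> 'a"
  assumes lin: "linear T" and sa: "\<And>x y. T x \<bullet> y = x \<bullet> T y"
    and S: "subspace S" and inv: "\<And>x. x \<in> S \<Longrightarrow> T x \<in> S"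
  shows "\<exists>B. finite B \<and> pairwise orthogonal B \<and> span B = S \<and>
    (\<forall>b\<in>B. norm b = 1 \<and> (\<exists>c. T b = c *\<^sub>R b))"
  using S inv
proof (induction "dim S" arbitrary: S rule: less_induct)
  case less
  show ?case
  proof (cases "S = {0}")
    case True
    then show ?thesis by (intro exI[of _ "{}"]) auto
  next
    case False
    obtain e c where e: "e \<in> S" "norm e = 1" "T e = c *\<^sub>R e"
      using selfadjoint_has_eigenvector[OF lin sa less.prems(1) False less.prems(2)] by blast
    have ee: "e \<bullet> e = 1"
      using e by (simp add: norm_eq_1)
    define S' where "S' = S \<inter> {x. orthogonal e x}"
    have S': "subspace S'"
      unfolding S'_def by (intro subspace_inter less.prems subspace_orthogonal_to_vector)
    have "e \<notin> S'"
      using ee by (auto simp: S'_def orthogonal_def)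
    then have "S' \<subset> S"
      using e by (auto simp: S'_def)
    then have "dim S' < dim S"
      using S' less.prems(1) by (intro dim_psubset) (metis span_eq_iff)
    moreover have "T x \<in> S'" if "x \<in> S'" for x
      using that less.prems(2)[of x] sa[of e x] e(3) by (auto simp: S'_def orthogonal_def)
    ultimately obtain B where B: "finite B" "pairwise orthogonal B" "span B = S'"
      "\<And>b. b \<in> B \<Longrightarrow> norm b = 1 \<and> (\<exists>c. T b = c *\<^sub>R b)"
      using less.hyps[OF _ S'] by metis
    have orth: "orthogonal e b" if "b \<in> B" for b
      using that B(3) span_base[of b B] by (auto simp: S'_def)
    have "span (insert e B) = S"
    proof
      show "span (insert e B) \<subseteq> S"
        using e B(3) span_superset[of B] less.prems(1) by (intro span_minimal) (auto simp: S'_def)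
      show "S \<subseteq> span (insert e B)"
      proof
        fix x assume x: "x \<in> S"
        have "x - (e \<bullet> x) *\<^sub>R e \<in> S'"
          using x e(1) ee less.prems(1)
          by (auto simp: S'_def orthogonal_def inner_simps subspace_diff subspace_scale)
        then show "x \<in> span (insert e B)"
          unfolding span_insert using B(3) by blast
      qed
    qed
    moreover have "pairwise orthogonal (insert e B)"
      using B(2) orth by (auto simp: pairwise_insert orthogonal_commute)
    ultimately show ?thesis
      using B(1,4) e by (intro exI[of _ "insert e B"]) auto
  qed
qed

lemma symmetric_matrix_eigenbasis:
  fixes A :: "real^'m^'m"
  assumes "transpose A = A"
  obtains p :: "'m \<Rightarrow> real^'m" and d :: "'m \<Rightarrow> real"
  where "\<And>i j. p i \<bullet> p j = (if i = j then 1 else 0)" and "\<And>i. A *v p i = d i *\<^sub>R p i"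
proof -
  have "A *v x = x v* A" for x
    using transpose_matrix_vector[of A x] unfolding assms .
  then have sa: "(A *v x) \<bullet> y = x \<bullet> (A *v y)" for x y
    by (simp only: dot_lmul_matrix)
  obtain B where B: "finite B" "pairwise orthogonal B" "span B = (UNIV :: (real^'m) set)"
    "\<And>b. b \<in> B \<Longrightarrow> norm b = 1 \<and> (\<exists>c. A *v b = c *\<^sub>R b)"
    using selfadjoint_orthonormal_eigenbasis[OF matrix_vector_mul_linear sa, of UNIV] by auto
  have "0 \<notin> B"
    using B(4) by fastforce
  then have "independent B"
    using B(2) by (simp add: pairwise_orthogonal_independent)
  then have "card B = CARD('m)"
    using dim_span_eq_card_independent[of B] B(3) by simp
  then obtain p where p: "bij_betw p (UNIV :: 'm set) B"
    using B(1) finite_same_card_bij[of "UNIV :: 'm set" B] by auto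
  have pB: "p i \<in> B" for i
    using p by (auto simp: bij_betw_def)
  have on: "p i \<bullet> p j = (if i = j then 1 else 0)" for i j
  proof (cases "i = j")
    case True
    then show ?thesis
      using B(4)[OF pB[of i]] by (simp add: norm_eq_1)
  next
    case False
    then have "p i \<noteq> p j"
      using p by (auto simp: bij_betw_def inj_def)
    then show ?thesis
      using False B(2) pB by (auto simp: pairwise_def orthogonal_def)
  qed
  have "\<forall>i. \<exists>c. A *v p i = c *\<^sub>R p i"
    using pB B(4) by blast
  then obtain d where "\<forall>i. A *v p i = d i *\<^sub>R p i"
    unfolding choice_iff ..
  with on show ?thesis
    by (intro that[of p d]) auto
qed

text \<open>
  Over the polynomial ring the matrix $xI - A$ satisfies $(xI - A) Q = Q D$, where \<open>Q\<close> has the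
  eigenvectors as columns and \<open>D\<close> is diagonal with entries $x - d_i$.  Take determinants and
  cancel $\det Q$, which is nonzero because $Q^T Q = I$.
\<close>

lemma charpoly_eq_prod_eigenvalues:
  fixes A :: "real^'m^'m" and p :: "'m \<Rightarrow> real^'m"
  assumes on: "\<And>i j. p i \<bullet> p j = (if i = j then 1 else 0)"
    and eig: "\<And>i. A *v p i = d i *\<^sub>R p i"
  shows "charpoly A = (\<Prod>i\<in>UNIV. [:- d i, 1:])"
proof -
  define M :: "real poly^'m^'m" where
    "M = (\<chi> i j. (if i = j then [:0, 1:] else 0) - [:A $ i $ j:])"
  define Q :: "real poly^'m^'m" where "Q = (\<chi> i j. [:p j $ i:])"
  define D :: "real poly^'m^'m" where "D = (\<chi> i j. if i = j then [:- d i, 1:] else 0)"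
  have sum_const: "(\<Sum>i\<in>I. [:h i:]) = [:\<Sum>i\<in>I. h i:]" for I :: "'m set" and h :: "'m \<Rightarrow> real"
    by (induction I rule: infinite_finite_induct) auto
  have "M ** Q = Q ** D"
  proof -
    have "(M ** Q) $ i $ j = (Q ** D) $ i $ j" for i j
    proof -
      have "(M ** Q) $ i $ j
          = (\<Sum>l\<in>UNIV. (if l = i then [:0, 1:] * [:p j $ l:] else 0) - [:A $ i $ l:] * [:p j $ l:])"
        unfolding matrix_matrix_mult_def M_def Q_def vec_lambda_beta
        by (intro sum.cong) (auto simp: left_diff_distrib simp del: mult_pCons_left mult_pCons_right)
      also have "\<dots> = [:0, 1:] * [:p j $ i:] - [:(A *v p j) $ i:]"
        by (simp add: sum_subtractf sum_const matrix_vector_mult_def mult.commute)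
      also have "\<dots> = [:p j $ i:] * [:- d j, 1:]"
        by (simp add: eig mult.commute)
      also have "\<dots> = (\<Sum>l\<in>UNIV. if l = j then [:p l $ i:] * [:- d j, 1:] else 0)"
        by simp
      also have "\<dots> = (Q ** D) $ i $ j"
        unfolding matrix_matrix_mult_def Q_def D_def vec_lambda_beta
        by (intro sum.cong) auto
      finally show ?thesis .
    qed
    then show ?thesis
      by (simp add: vec_eq_iff)
  qed
  then have "det M * det Q = det Q * det D"
    by (metis det_mul)
  moreover have "transpose Q ** Q = mat 1"
    using on by (simp add: vec_eq_iff matrix_matrix_mult_def transpose_def Q_def mat_def sum_const
        inner_vec_def)
  then have "det Q \<noteq> 0"
    by (metis det_I det_mul mult_zero_right zero_neq_one)
  ultimately have "det M = det D"
    by simp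
  also have "\<dots> = (\<Prod>i\<in>UNIV. [:- d i, 1:])"
    by (subst det_diagonal) (auto simp: D_def)
  finally show ?thesis
    by (simp add: charpoly_def M_def)
qed

text \<open>
  Diagonalizing $Z Z^T$ gives left singular vectors \<open>p i\<close>; the vectors $Z^T p_i$ are then
  orthogonal with squared norms equal to the eigenvalues.
\<close>

lemma singular_values_eigenbasis:
  fixes Z :: "real^'n^'m"
  obtains p :: "'m \<Rightarrow> real^'m" and s :: "'m \<Rightarrow> real"
  where "\<And>i j. p i \<bullet> p j = (if i = j then 1 else 0)"
    and "\<And>i j. (transpose Z *v p i) \<bullet> (transpose Z *v p j) = (if i = j then (s i)\<^sup>2 else 0)"
    and "\<And>i. 0 \<le> s i"
    and "mset (singular_values Z) = image_mset s (mset_set UNIV)"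
    and "sorted_wrt (\<ge>) (singular_values Z)"
proof -
  let ?A = "Z ** transpose Z"
  obtain p :: "'m \<Rightarrow> real^'m" and d where on: "\<And>i j. p i \<bullet> p j = (if i = j then 1 else 0)"
    and eig: "\<And>i. ?A *v p i = d i *\<^sub>R p i"
    using symmetric_matrix_eigenbasis[of ?A] by (auto simp: matrix_transpose_mul)
  have ip: "(transpose Z *v p i) \<bullet> (transpose Z *v p j) = (if i = j then d i else 0)" for i j
  proof -
    have "(transpose Z *v p i) \<bullet> (transpose Z *v p j) = p i \<bullet> (?A *v p j)"
      using dot_lmul_matrix[of "p i" Z "transpose Z *v p j"]
      by (simp add: matrix_vector_mul_assoc[symmetric])
    then show ?thesis
      by (simp add: eig on)
  qed
  have d: "0 \<le> d i" for i
    using ip[of i i] inner_ge_zero[of "transpose Z *v p i"] by simp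
  have "proots (charpoly ?A) = (\<Sum>i\<in>UNIV. {#d i#})"
    unfolding charpoly_eq_prod_eigenvalues[OF on eig] by (subst proots_prod) auto
  also have "\<dots> = image_mset d (mset_set UNIV)"
    by (simp add: sum_unfold_sum_mset)
  finally have m: "mset (singular_values Z) = image_mset (\<lambda>i. sqrt (d i)) (mset_set UNIV)"
    by (simp add: singular_values_def multiset.map_comp comp_def)
  have sorted: "sorted_wrt (\<ge>) (singular_values Z)"
    unfolding singular_values_def by (simp add: sorted_wrt_rev)
  show ?thesis
    by (rule that[of p "\<lambda>i. sqrt (d i)"]) (use on ip d m sorted in auto)
qed

section \<open>Ky Fan's variational principle\<close>

text \<open>
  Besides orthonormal families this admits zero vectors, which serve as right singular vectors
  for vanishing singular values and make the singular value decomposition independent of which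
  of the two dimensions is larger.  Bessel's inequality holds as for orthonormal families.
\<close>

definition orthosubnormal :: "'i set \<Rightarrow> ('i \<Rightarrow> 'a::real_inner) \<Rightarrow> bool" where
  "orthosubnormal I w \<longleftrightarrow>
     (\<forall>i\<in>I. norm (w i) \<le> 1) \<and> (\<forall>i\<in>I. \<forall>j\<in>I. i \<noteq> j \<longrightarrow> w i \<bullet> w j = 0)"

lemma orthosubnormal_subset: "orthosubnormal I w \<Longrightarrow> J \<subseteq> I \<Longrightarrow> orthosubnormal J w"
  by (auto simp: orthosubnormal_def)

lemma bessel_inequality:
  assumes "finite I" and w: "orthosubnormal I w"
  shows "(\<Sum>i\<in>I. (w i \<bullet> x)\<^sup>2) \<le> (norm x)\<^sup>2"
proof -
  let ?y = "\<Sum>i\<in>I. (w i \<bullet> x) *\<^sub>R w i"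
  have "?y \<bullet> ?y = (\<Sum>i\<in>I. \<Sum>j\<in>I. (w i \<bullet> x) * (w j \<bullet> x) * (w i \<bullet> w j))"
    by (simp add: inner_sum_left inner_sum_right mult.assoc sum_distrib_left)
      (simp add: mult.left_commute inner_commute)
  also have "\<dots> = (\<Sum>i\<in>I. \<Sum>j\<in>I. if j = i then (w i \<bullet> x)\<^sup>2 * (norm (w i))\<^sup>2 else 0)"
    using w by (intro sum.cong refl)
      (auto simp: orthosubnormal_def power2_eq_square dot_square_norm)
  also have "\<dots> = (\<Sum>i\<in>I. (w i \<bullet> x)\<^sup>2 * (norm (w i))\<^sup>2)"
    using \<open>finite I\<close> by simp
  also have "\<dots> \<le> (\<Sum>i\<in>I. (w i \<bullet> x)\<^sup>2 * 1)"
    using w by (intro sum_mono mult_left_mono) (auto simp: orthosubnormal_def power_le_one)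
  finally have "?y \<bullet> ?y \<le> (\<Sum>i\<in>I. (w i \<bullet> x)\<^sup>2)"
    by simp
  moreover have "?y \<bullet> x = (\<Sum>i\<in>I. (w i \<bullet> x)\<^sup>2)"
    by (simp add: inner_sum_left power2_eq_square)
  moreover have "0 \<le> (x - ?y) \<bullet> (x - ?y)"
    by simp
  then have "0 \<le> x \<bullet> x - 2 * (?y \<bullet> x) + ?y \<bullet> ?y"
    by (simp only: inner_diff_left inner_diff_right inner_commute[of x ?y])
  ultimately show ?thesis
    by (simp add: power2_norm_eq_inner)
qed

text \<open>
  A matrix with orthonormal rows is square here, so $P P^T = I$ implies $P^T P = I$.
\<close>

lemma orthonormal_expansion:
  fixes p :: "'m::finite \<Rightarrow> real^'m"
  assumes on: "\<And>i j. p i \<bullet> p j = (if i = j then 1 else 0)"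
  shows "(\<Sum>i\<in>UNIV. (p i \<bullet> x) *\<^sub>R p i) = x"
proof -
  define P :: "real^'m^'m" where "P = (\<chi> i. p i)"
  have "P ** transpose P = mat 1"
    using on by (simp add: vec_eq_iff matrix_matrix_mult_def transpose_def P_def mat_def inner_vec_def)
  then have "transpose P ** P = mat 1"
    by (simp add: matrix_left_right_inverse)
  then have "transpose P *v (P *v x) = x"
    by (simp add: matrix_vector_mul_assoc del: transpose_matrix_vector)
  moreover have "transpose P *v (P *v x) = (\<Sum>i\<in>UNIV. (p i \<bullet> x) *\<^sub>R p i)"
    by (simp add: vec_eq_iff P_def transpose_def matrix_vector_mult_def inner_vec_def mult.commute
        del: transpose_matrix_vector)
  ultimately show ?thesis
    by simp
qed

text \<open>
  The first \<open>k\<close> entries of a list sorted downwards are the values of \<open>s\<close> on some index set \<open>J\<close>.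
  The threshold \<open>t\<close>, the smallest of these values, separates \<open>J\<close> from the other indices; this is
  how the sorted list enters the estimates below.
\<close>

lemma sum_of_largest_entries:
  fixes s :: "'i \<Rightarrow> real"
  assumes A: "finite A" and k: "1 \<le> k" "k \<le> card A"
    and xs: "mset xs = image_mset s (mset_set A)" "sorted_wrt (\<ge>) xs"
  obtains J t where "J \<subseteq> A" "card J = k" "sum_list (take k xs) = sum s J" "t \<in> s ` J"
    "\<And>i. i \<in> J \<Longrightarrow> t \<le> s i" "\<And>i. i \<in> A - J \<Longrightarrow> s i \<le> t"
proof -
  obtain zs where zs: "set zs = A" "distinct zs"
    using finite_distinct_list[OF A] by blast
  define ys where "ys = rev (sort_key s zs)"
  have ys: "set ys = A" "distinct ys" "length ys = card A"
    using zs by (auto simp: ys_def distinct_card)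
  have "sorted (rev xs)"
    using xs(2) by (simp add: sorted_wrt_rev)
  moreover have "mset (rev xs) = mset (map s (sort_key s zs))"
    using xs(1) zs by (simp add: mset_set_set[symmetric])
  ultimately have "rev xs = map s (sort_key s zs)"
    by (metis properties_for_sort sorted_sort_key)
  then have xs_eq: "xs = map s ys"
    by (simp add: ys_def rev_map rev_swap)
  have desc: "s (ys ! j) \<le> s (ys ! i)" if "i \<le> j" "j < length ys" for i j
    using that xs(2) unfolding xs_eq
    by (cases "i = j") (auto simp: sorted_wrt_iff_nth_less)
  define J where "J = set (take k ys)"
  have J: "J = (!) ys ` {..<k}"
    using nth_image[of k ys] k ys by (simp add: J_def atLeast0LessThan)
  show ?thesis
  proof (rule that[of J "s (ys ! (k - 1))"])
    show "J \<subseteq> A"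
      using ys by (auto simp: J_def dest: in_set_takeD)
    show "card J = k"
      using ys k by (simp add: J_def distinct_card)
    show "sum_list (take k xs) = sum s J"
      using ys by (simp add: xs_eq J_def take_map sum_list_distinct_conv_sum_set)
    show "s (ys ! (k - 1)) \<in> s ` J"
      using k by (auto simp: J)
    show "s (ys ! (k - 1)) \<le> s i" if "i \<in> J" for i
      using that k ys by (auto simp: J intro!: desc)
    show "s i \<le> s (ys ! (k - 1))" if i: "i \<in> A - J" for i
    proof -
      from i obtain l where l: "l < length ys" "i = ys ! l"
        using ys by (metis DiffD1 in_set_conv_nth)
      with i have "\<not> l < k"
        by (auto simp: J)
      with l show ?thesis
        by (auto intro!: desc)
    qed
  qed
qed

text \<open>
  Subtract the threshold: $\sum_i c_i (s_i - t)$ is largest if $c_i = 1$ on \<open>J\<close> and $c_i = 0$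
  elsewhere, and $t \sum_i c_i$ is at most \<open>t * card J\<close>.
\<close>

lemma weighted_sum_le_sum_of_largest:
  fixes s c :: "'i \<Rightarrow> real"
  assumes A: "finite A" "J \<subseteq> A" and t: "0 \<le> t"
    and above: "\<And>i. i \<in> J \<Longrightarrow> t \<le> s i" and below: "\<And>i. i \<in> A - J \<Longrightarrow> s i \<le> t"
    and c: "\<And>i. i \<in> A \<Longrightarrow> 0 \<le> c i" "\<And>i. i \<in> A \<Longrightarrow> c i \<le> 1" "sum c A \<le> card J"
  shows "(\<Sum>i\<in>A. c i * s i) \<le> sum s J"
proof -
  have J: "finite J"
    using A finite_subset by blast
  have "(\<Sum>i\<in>A. c i * s i) = (\<Sum>i\<in>A. c i * (s i - t)) + t * sum c A"
    by (simp add: sum_distrib_left sum.distrib[symmetric] algebra_simps)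
  also have "(\<Sum>i\<in>A. c i * (s i - t)) \<le> (\<Sum>i\<in>A. if i \<in> J then s i - t else 0)"
  proof (rule sum_mono)
    fix i assume "i \<in> A"
    then show "c i * (s i - t) \<le> (if i \<in> J then s i - t else 0)"
      using mult_right_mono[of "c i" 1 "s i - t"] above[of i] below[of i] c(1,2)[of i]
      by (auto intro: mult_nonneg_nonpos)
  qed
  also have "\<dots> = (\<Sum>i\<in>J. s i - t)"
    using A by (simp add: sum.inter_restrict[symmetric] Int_absorb1)
  also have "t * sum c A \<le> t * card J"
    using c(3) t by (rule mult_left_mono)
  finally show ?thesis
    by (simp add: sum_subtractf mult.commute)
qed

text \<open>
  The decomposition $Z = \sum_i s_i p_i q_i^T$ in weak form.  The vector \<open>q i\<close> is $Z^T p_i / s_i$,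
  which is zero if \<open>s i = 0\<close>; in all cases \<open>s i * (q i \<bullet> q i) = s i\<close>.
\<close>

lemma singular_value_decomposition:
  fixes Z :: "real^'n^'m"
  obtains p :: "'m \<Rightarrow> real^'m" and q :: "'m \<Rightarrow> real^'n" and s :: "'m \<Rightarrow> real"
  where "\<And>i j. p i \<bullet> p j = (if i = j then 1 else 0)" and "orthosubnormal UNIV q"
    and "\<And>i. s i * (q i \<bullet> q i) = s i"
    and "\<And>x y. x \<bullet> (Z *v y) = (\<Sum>i\<in>UNIV. s i * ((x \<bullet> p i) * (q i \<bullet> y)))"
    and "\<And>i. 0 \<le> s i"
    and "mset (singular_values Z) = image_mset s (mset_set UNIV)"
    and "sorted_wrt (\<ge>) (singular_values Z)"
proof -
  obtain p :: "'m \<Rightarrow> real^'m" and s :: "'m \<Rightarrow> real"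
    where on: "\<And>i j. p i \<bullet> p j = (if i = j then 1 else 0)"
    and Zp: "\<And>i j. (transpose Z *v p i) \<bullet> (transpose Z *v p j) = (if i = j then (s i)\<^sup>2 else 0)"
    and s: "\<And>i. 0 \<le> s i" "mset (singular_values Z) = image_mset s (mset_set UNIV)"
      "sorted_wrt (\<ge>) (singular_values Z)"
    by (rule singular_values_eigenbasis[of Z]) blast
  define q where "q i = (transpose Z *v p i) /\<^sub>R s i" for i
  have sq: "s i *\<^sub>R q i = transpose Z *v p i" for i
  proof (cases "s i = 0")
    case True
    then have "transpose Z *v p i = 0"
      using Zp[of i i] inner_eq_zero_iff[of "transpose Z *v p i"] by simp
    with True show ?thesis
      by simp
  qed (simp add: q_def)
  have qq: "q i \<bullet> q j = (if i = j \<and> s i \<noteq> 0 then 1 else 0)" for i j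
    using Zp[of i j] by (simp add: q_def power2_eq_square field_simps del: transpose_matrix_vector)
  have "norm (q i) \<le> 1" for i
    using qq[of i i] by (simp add: norm_eq_sqrt_inner)
  then have "orthosubnormal UNIV q"
    by (simp add: orthosubnormal_def qq)
  moreover have "x \<bullet> (Z *v y) = (\<Sum>i\<in>UNIV. s i * ((x \<bullet> p i) * (q i \<bullet> y)))" for x y
  proof -
    have "x \<bullet> (Z *v y) = (\<Sum>i\<in>UNIV. (p i \<bullet> x) *\<^sub>R p i) \<bullet> (Z *v y)"
      by (simp add: orthonormal_expansion[OF on])
    also have "\<dots> = (\<Sum>i\<in>UNIV. (p i \<bullet> x) * (p i \<bullet> (Z *v y)))"
      by (simp add: inner_sum_left)
    also have "\<dots> = (\<Sum>i\<in>UNIV. s i * ((x \<bullet> p i) * (q i \<bullet> y)))"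
    proof (rule sum.cong)
      fix i
      have "p i \<bullet> (Z *v y) = (s i *\<^sub>R q i) \<bullet> y"
        unfolding sq by (simp add: dot_lmul_matrix)
      then show "(p i \<bullet> x) * (p i \<bullet> (Z *v y)) = s i * ((x \<bullet> p i) * (q i \<bullet> y))"
        by (simp add: inner_commute)
    qed simp
    finally show ?thesis .
  qed
  ultimately show ?thesis
    using that[of p q s] on qq s by simp
qed

text \<open>
  By the singular value decomposition the left-hand side is a sum of the singular values with
  weights $\sum_j \langle u_j, p_i\rangle \langle q_i, v_j\rangle$.  By the arithmetic-geometric
  mean inequality these are at most the numbers \<open>c i\<close> in the proof.  Bessel's inequality for
  \<open>u\<close> and \<open>v\<close> gives $c_i \le 1$, and for \<open>p\<close> and \<open>q\<close> it gives $\sum_i c_i \le k$.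
\<close>

lemma ky_fan_norm_upper_bound:
  fixes Z :: "real^'n^'m" and u :: "'i \<Rightarrow> real^'m" and v :: "'i \<Rightarrow> real^'n"
  assumes k: "1 \<le> k" "k \<le> CARD('m)" and I: "finite I" "card I = k"
    and u: "orthosubnormal I u" and v: "orthosubnormal I v"
  shows "(\<Sum>j\<in>I. u j \<bullet> (Z *v v j)) \<le> ky_fan_norm k Z"
proof -
  obtain p :: "'m \<Rightarrow> real^'m" and q :: "'m \<Rightarrow> real^'n" and s :: "'m \<Rightarrow> real"
    where on: "\<And>i j. p i \<bullet> p j = (if i = j then 1 else 0)" and q: "orthosubnormal UNIV q"
    and svd: "\<And>x y. x \<bullet> (Z *v y) = (\<Sum>i\<in>UNIV. s i * ((x \<bullet> p i) * (q i \<bullet> y)))"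
    and s: "\<And>i. 0 \<le> s i"
    and sv: "mset (singular_values Z) = image_mset s (mset_set UNIV)"
      "sorted_wrt (\<ge>) (singular_values Z)"
    by (rule singular_value_decomposition[of Z]) blast
  have p: "orthosubnormal UNIV p"
    using on by (simp add: orthosubnormal_def norm_eq_sqrt_inner)
  obtain J t where J: "J \<subseteq> UNIV" "card J = k" "sum_list (take k (singular_values Z)) = sum s J"
    "t \<in> s ` J" "\<And>i. i \<in> J \<Longrightarrow> t \<le> s i" "\<And>i. i \<in> UNIV - J \<Longrightarrow> s i \<le> t"
    using sum_of_largest_entries[OF finite k sv] by blast
  define c where "c i = (\<Sum>j\<in>I. ((u j \<bullet> p i)\<^sup>2 + (v j \<bullet> q i)\<^sup>2) / 2)" for i
  have le1: "(norm x)\<^sup>2 \<le> 1" if "norm x \<le> 1" for x :: "'b::real_normed_vector"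
    using that by (simp add: power_le_one)
  have "(\<Sum>j\<in>I. u j \<bullet> (Z *v v j)) = (\<Sum>i\<in>UNIV. \<Sum>j\<in>I. s i * ((u j \<bullet> p i) * (q i \<bullet> v j)))"
    unfolding svd by (rule sum.swap)
  also have "\<dots> \<le> (\<Sum>i\<in>UNIV. \<Sum>j\<in>I. s i * (((u j \<bullet> p i)\<^sup>2 + (v j \<bullet> q i)\<^sup>2) / 2))"
  proof (intro sum_mono mult_left_mono s)
    fix i j
    show "(u j \<bullet> p i) * (q i \<bullet> v j) \<le> ((u j \<bullet> p i)\<^sup>2 + (v j \<bullet> q i)\<^sup>2) / 2"
      using sum_squares_bound[of "u j \<bullet> p i" "v j \<bullet> q i"] by (simp add: inner_commute[of "q i"])
  qed
  also have "\<dots> = (\<Sum>i\<in>UNIV. c i * s i)"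
    unfolding c_def sum_distrib_right by (simp add: mult.commute)
  also have "\<dots> \<le> sum s J"
  proof (rule weighted_sum_le_sum_of_largest[where t = t])
    show "0 \<le> t"
      using J(4) s by auto
    show "0 \<le> c i" for i
      by (simp add: c_def sum_nonneg)
    show "c i \<le> 1" for i
    proof -
      have "c i = ((\<Sum>j\<in>I. (u j \<bullet> p i)\<^sup>2) + (\<Sum>j\<in>I. (v j \<bullet> q i)\<^sup>2)) / 2"
        by (simp add: c_def sum.distrib sum_divide_distrib[symmetric])
      moreover have "(\<Sum>j\<in>I. (u j \<bullet> p i)\<^sup>2) \<le> 1"
        by (rule order_trans[OF bessel_inequality[OF I(1) u] le1]) (use p in \<open>simp add: orthosubnormal_def\<close>)
      moreover have "(\<Sum>j\<in>I. (v j \<bullet> q i)\<^sup>2) \<le> 1"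
        by (rule order_trans[OF bessel_inequality[OF I(1) v] le1]) (use q in \<open>simp add: orthosubnormal_def\<close>)
      ultimately show ?thesis
        by simp
    qed
    have "sum c UNIV = (\<Sum>j\<in>I. ((\<Sum>i\<in>UNIV. (p i \<bullet> u j)\<^sup>2) + (\<Sum>i\<in>UNIV. (q i \<bullet> v j)\<^sup>2)) / 2)"
      unfolding c_def by (subst sum.swap)
        (simp add: sum.distrib sum_divide_distrib[symmetric] inner_commute)
    also have "\<dots> \<le> (\<Sum>j\<in>I. 1)"
    proof (rule sum_mono)
      fix j assume "j \<in> I"
      then have "(norm (u j))\<^sup>2 \<le> 1" "(norm (v j))\<^sup>2 \<le> 1"
        using u v by (auto simp: orthosubnormal_def le1)
      then show "((\<Sum>i\<in>UNIV. (p i \<bullet> u j)\<^sup>2) + (\<Sum>i\<in>UNIV. (q i \<bullet> v j)\<^sup>2)) / 2 \<le> 1"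
        using bessel_inequality[OF finite p, of "u j"] bessel_inequality[OF finite q, of "v j"]
        by simp
    qed
    finally show "sum c UNIV \<le> card J"
      using I J by simp
  qed (use J in auto)
  finally show ?thesis
    using J by (simp add: ky_fan_norm_def)
qed

text \<open>
  The singular vectors that belong to the \<open>k\<close> largest singular values attain the bound.
\<close>

lemma ky_fan_norm_attained:
  fixes Z :: "real^'n^'m"
  assumes k: "1 \<le> k" "k \<le> CARD('m)"
  obtains I :: "'m set" and u :: "'m \<Rightarrow> real^'m" and v :: "'m \<Rightarrow> real^'n"
  where "card I = k" "orthosubnormal I u" "orthosubnormal I v"
    "ky_fan_norm k Z = (\<Sum>j\<in>I. u j \<bullet> (Z *v v j))"
proof -
  obtain p :: "'m \<Rightarrow> real^'m" and q :: "'m \<Rightarrow> real^'n" and s :: "'m \<Rightarrow> real"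
    where on: "\<And>i j. p i \<bullet> p j = (if i = j then 1 else 0)" and q: "orthosubnormal UNIV q"
    and sq: "\<And>i. s i * (q i \<bullet> q i) = s i"
    and svd: "\<And>x y. x \<bullet> (Z *v y) = (\<Sum>i\<in>UNIV. s i * ((x \<bullet> p i) * (q i \<bullet> y)))"
    and sv: "mset (singular_values Z) = image_mset s (mset_set UNIV)"
      "sorted_wrt (\<ge>) (singular_values Z)"
    by (rule singular_value_decomposition[of Z]) blast
  have p: "orthosubnormal UNIV p"
    using on by (simp add: orthosubnormal_def norm_eq_sqrt_inner)
  obtain J where J: "card J = k" "sum_list (take k (singular_values Z)) = sum s J"
    using sum_of_largest_entries[OF finite k sv] by blast
  have "p j \<bullet> (Z *v q j) = s j" for j
  proof -
    have "p j \<bullet> (Z *v q j) = (\<Sum>i\<in>UNIV. if i = j then s j * (q j \<bullet> q j) else 0)"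
      unfolding svd on by (intro sum.cong) auto
    then show ?thesis
      by (simp add: sq)
  qed
  then have "ky_fan_norm k Z = (\<Sum>j\<in>J. p j \<bullet> (Z *v q j))"
    using J by (simp add: ky_fan_norm_def)
  then show ?thesis
    using orthosubnormal_subset[OF p] orthosubnormal_subset[OF q]
    by (intro that[of J p q] J(1)) auto
qed

text \<open>
  Families that attain the maximum for a convex combination are admissible for both of its terms.
\<close>

theorem convex_on_ky_fan_norm:
  assumes k: "1 \<le> k" "k \<le> CARD('m)"
  shows "convex_on UNIV (ky_fan_norm k :: real^'n^'m \<Rightarrow> real)"
proof (rule convex_onI)
  fix t :: real and A B :: "real^'n^'m"
  assume t: "0 < t" "t < 1"
  let ?C = "(1 - t) *\<^sub>R A + t *\<^sub>R B"
  obtain I :: "'m set" and u :: "'m \<Rightarrow> real^'m" and v :: "'m \<Rightarrow> real^'n"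
    where I: "card I = k" "orthosubnormal I u" "orthosubnormal I v"
    and C: "ky_fan_norm k ?C = (\<Sum>j\<in>I. u j \<bullet> (?C *v v j))"
    by (rule ky_fan_norm_attained[OF k])
  note ub = ky_fan_norm_upper_bound[OF k finite I]
  have "ky_fan_norm k ?C = (1 - t) * (\<Sum>j\<in>I. u j \<bullet> (A *v v j)) + t * (\<Sum>j\<in>I. u j \<bullet> (B *v v j))"
    unfolding C by (simp add: matrix_vector_mult_add_rdistrib scaleR_matrix_vector_assoc[symmetric]
        inner_add_right sum.distrib sum_distrib_left)
  also have "\<dots> \<le> (1 - t) * ky_fan_norm k A + t * ky_fan_norm k B"
    using t by (intro add_mono mult_left_mono ub) auto
  finally show "ky_fan_norm k ?C \<le> (1 - t) * ky_fan_norm k A + t * ky_fan_norm k B" .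
qed simp

section \<open>Directional derivatives and subgradients of convex functions\<close>

lemma diff_quotient_mono:
  fixes \<theta> :: "'b::real_vector \<Rightarrow> real"
  assumes cv: "convex_on UNIV \<theta>" and st: "0 < s" "s \<le> t"
  shows "(\<theta> (X + s *\<^sub>R H) - \<theta> X) / s \<le> (\<theta> (X + t *\<^sub>R H) - \<theta> X) / t"
proof -
  have "X + s *\<^sub>R H = (1 - s / t) *\<^sub>R X + (s / t) *\<^sub>R (X + t *\<^sub>R H)"
    using st by (simp add: algebra_simps)
  then have "\<theta> (X + s *\<^sub>R H) \<le> (1 - s / t) * \<theta> X + (s / t) * \<theta> (X + t *\<^sub>R H)"
    using convex_onD[OF cv, of "s / t" X "X + t *\<^sub>R H"] st by simp
  then have "\<theta> (X + s *\<^sub>R H) - \<theta> X \<le> s * ((\<theta> (X + t *\<^sub>R H) - \<theta> X) / t)"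
    by (simp add: algebra_simps diff_divide_distrib)
  then show ?thesis
    using st by (simp add: pos_divide_le_eq mult.commute)
qed

text \<open>
  The point \<open>X\<close> lies between \<open>X - H\<close> and \<open>X + t *\<^sub>R H\<close>.  The bound does not depend on \<open>t\<close>, so the
  monotone difference quotients have a finite limit.
\<close>

lemma diff_quotient_lower_bound:
  fixes \<theta> :: "'b::real_vector \<Rightarrow> real"
  assumes cv: "convex_on UNIV \<theta>" and t: "0 < t"
  shows "\<theta> X - \<theta> (X - H) \<le> (\<theta> (X + t *\<^sub>R H) - \<theta> X) / t"
proof -
  have w: "1 - t / (1 + t) = 1 / (1 + t)"
    using t by (simp add: field_simps)
  have "1 / (1 + t) + t / (1 + t) = 1"
    using t by (simp add: add_divide_distrib[symmetric])
  then have "(1 / (1 + t)) *\<^sub>R X + (t / (1 + t)) *\<^sub>R X = X"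
    by (simp add: scaleR_add_left[symmetric] del: scaleR_add_left)
  then have "X = (1 - t / (1 + t)) *\<^sub>R (X + t *\<^sub>R H) + (t / (1 + t)) *\<^sub>R (X - H)"
    unfolding w by (simp add: scaleR_add_right scaleR_diff_right)
  then have "\<theta> X \<le> 1 / (1 + t) * \<theta> (X + t *\<^sub>R H) + t / (1 + t) * \<theta> (X - H)"
    using convex_onD[OF cv, of "t / (1 + t)" "X + t *\<^sub>R H" "X - H"] t by (simp add: w)
  then have "(1 + t) * \<theta> X \<le> (1 + t) * (1 / (1 + t) * \<theta> (X + t *\<^sub>R H) + t / (1 + t) * \<theta> (X - H))"
    using t by (intro mult_left_mono) auto
  also have "\<dots> = \<theta> (X + t *\<^sub>R H) + t * \<theta> (X - H)"
    using t by (simp add: distrib_left)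
  finally show ?thesis
    using t by (simp add: field_simps)
qed

lemma dir_deriv_tendsto:
  fixes \<theta> :: "'b::real_normed_vector \<Rightarrow> real"
  assumes cv: "convex_on UNIV \<theta>"
  shows "((\<lambda>t. (\<theta> (X + t *\<^sub>R H) - \<theta> X) / t) \<longlongrightarrow> dir_deriv \<theta> X H) (at_right 0)"
    and "0 < t \<Longrightarrow> dir_deriv \<theta> X H \<le> (\<theta> (X + t *\<^sub>R H) - \<theta> X) / t"
proof -
  let ?Q = "\<lambda>t. (\<theta> (X + t *\<^sub>R H) - \<theta> X) / t"
  define D where "D = (INF t\<in>{0<..}. ?Q t)"
  have bdd: "bdd_below (?Q ` {0<..})"
    using diff_quotient_lower_bound[OF cv] by (intro bdd_belowI[of _ "\<theta> X - \<theta> (X - H)"]) auto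
  have le: "D \<le> ?Q t" if "0 < t" for t
    unfolding D_def using that bdd by (intro cINF_lower) auto
  have "(?Q \<longlongrightarrow> D) (at_right 0)"
  proof (rule order_tendstoI)
    fix a assume "a < D"
    then show "\<forall>\<^sub>F t in at_right 0. a < ?Q t"
      using le by (intro eventually_at_right_less[THEN eventually_mono]) (auto intro: less_le_trans)
  next
    fix a assume "D < a"
    then obtain s where s: "0 < s" "?Q s < a"
      unfolding D_def using cINF_less_iff[OF _ bdd, of a] by auto
    have "\<forall>\<^sub>F t in at_right 0. 0 < t \<and> t < s"
      using s by (simp add: eventually_at_right_field) (metis)
    then show "\<forall>\<^sub>F t in at_right 0. ?Q t < a"
    proof (rule eventually_mono)
      fix t assume "0 < t \<and> t < s"
      then have "?Q t \<le> ?Q s"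
        by (intro diff_quotient_mono[OF cv]) auto
      with s show "?Q t < a"
        by linarith
    qed
  qed
  moreover from this have "dir_deriv \<theta> X H = D"
    unfolding dir_deriv_def by (intro tendsto_Lim) auto
  ultimately show "(?Q \<longlongrightarrow> dir_deriv \<theta> X H) (at_right 0)"
    and "0 < t \<Longrightarrow> dir_deriv \<theta> X H \<le> ?Q t"
    using le by auto
qed

lemma le_dir_derivI:
  fixes \<theta> :: "'b::real_normed_vector \<Rightarrow> real"
  assumes cv: "convex_on UNIV \<theta>"
    and le: "\<And>t. 0 < t \<Longrightarrow> a \<le> (\<theta> (X + t *\<^sub>R H) - \<theta> X) / t"
  shows "a \<le> dir_deriv \<theta> X H"
proof (rule tendsto_lowerbound[OF dir_deriv_tendsto(1)[OF cv]])
  show "\<forall>\<^sub>F t in at_right 0. a \<le> (\<theta> (X + t *\<^sub>R H) - \<theta> X) / t"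
    using eventually_at_right_less by (rule eventually_mono) (rule le)
qed simp

lemma dir_deriv_zero [simp]: "dir_deriv \<theta> X 0 = 0"
  unfolding dir_deriv_def by (rule tendsto_Lim) auto

lemma dir_deriv_scale:
  fixes \<theta> :: "'b::real_normed_vector \<Rightarrow> real"
  assumes cv: "convex_on UNIV \<theta>" and c: "0 < c"
  shows "dir_deriv \<theta> X (c *\<^sub>R H) = c * dir_deriv \<theta> X H"
proof -
  have le: "dir_deriv \<theta> X (c *\<^sub>R H) \<le> c * dir_deriv \<theta> X H" if c: "0 < c" for c H
  proof -
    have "dir_deriv \<theta> X (c *\<^sub>R H) / c \<le> dir_deriv \<theta> X H"
    proof (rule le_dir_derivI[OF cv])
      fix t :: real assume "0 < t"
      then show "dir_deriv \<theta> X (c *\<^sub>R H) / c \<le> (\<theta> (X + t *\<^sub>R H) - \<theta> X) / t"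
        using dir_deriv_tendsto(2)[OF cv, of "t / c" X "c *\<^sub>R H"] c by (simp add: field_simps)
    qed
    with c show ?thesis
      by (simp add: field_simps)
  qed
  have "dir_deriv \<theta> X H \<le> dir_deriv \<theta> X (c *\<^sub>R H) / c"
    using le[of "1 / c" "c *\<^sub>R H"] c by simp
  then show ?thesis
    using le[OF c, of H] c by (simp add: field_simps)
qed

lemma dir_deriv_add_le:
  fixes \<theta> :: "'b::real_normed_vector \<Rightarrow> real"
  assumes cv: "convex_on UNIV \<theta>"
  shows "dir_deriv \<theta> X (H + K) \<le> dir_deriv \<theta> X H + dir_deriv \<theta> X K"
proof (rule tendsto_lowerbound)
  show "((\<lambda>t. (\<theta> (X + t *\<^sub>R H) - \<theta> X) / t + (\<theta> (X + t *\<^sub>R K) - \<theta> X) / t)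
      \<longlongrightarrow> dir_deriv \<theta> X H + dir_deriv \<theta> X K) (at_right 0)"
    by (intro tendsto_add dir_deriv_tendsto cv)
  have "dir_deriv \<theta> X (H + K) \<le> (\<theta> (X + t *\<^sub>R H) - \<theta> X) / t + (\<theta> (X + t *\<^sub>R K) - \<theta> X) / t"
    if t: "0 < t" for t
  proof -
    have "X + (t / 2) *\<^sub>R (H + K) = (1 - 1 / 2) *\<^sub>R (X + t *\<^sub>R H) + (1 / 2) *\<^sub>R (X + t *\<^sub>R K)"
      by (simp add: algebra_simps) (simp add: scaleR_add_left[symmetric])
    then have "\<theta> (X + (t / 2) *\<^sub>R (H + K)) \<le> (\<theta> (X + t *\<^sub>R H) + \<theta> (X + t *\<^sub>R K)) / 2"
      using convex_onD[OF cv, of "1 / 2" "X + t *\<^sub>R H" "X + t *\<^sub>R K"] by simp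
    then have "(\<theta> (X + (t / 2) *\<^sub>R (H + K)) - \<theta> X) / (t / 2)
        \<le> ((\<theta> (X + t *\<^sub>R H) + \<theta> (X + t *\<^sub>R K)) / 2 - \<theta> X) / (t / 2)"
      using t by (intro divide_right_mono) auto
    also have "\<dots> = (\<theta> (X + t *\<^sub>R H) - \<theta> X) / t + (\<theta> (X + t *\<^sub>R K) - \<theta> X) / t"
      using t by (simp add: field_simps)
    finally show ?thesis
      using dir_deriv_tendsto(2)[OF cv, of "t / 2" X "H + K"] t by linarith
  qed
  then show "\<forall>\<^sub>F t in at_right 0. dir_deriv \<theta> X (H + K)
      \<le> (\<theta> (X + t *\<^sub>R H) - \<theta> X) / t + (\<theta> (X + t *\<^sub>R K) - \<theta> X) / t"
    by (intro eventually_at_right_less[THEN eventually_mono])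
qed simp

text \<open>
  The Hahn-Banach theorem in finite dimension: separate the strict epigraph \<open>E\<close> of \<open>q\<close> from the
  graph \<open>L\<close> of the functional on \<open>R\<close>.  The separating hyperplane is not vertical because \<open>q\<close> is finite
  everywhere, so it is the graph of a linear functional.
\<close>

lemma sublinear_dominated_extension:
  fixes q :: "'b::euclidean_space \<Rightarrow> real"
  assumes add: "\<And>x y. q (x + y) \<le> q x + q y"
    and scale: "\<And>c x. 0 < c \<Longrightarrow> q (c *\<^sub>R x) = c * q x"
    and R: "subspace R" and V: "\<And>y. y \<in> R \<Longrightarrow> V \<bullet> y \<le> q y"
  obtains S where "\<And>y. S \<bullet> y \<le> q y" "\<And>y. y \<in> R \<Longrightarrow> S \<bullet> y = V \<bullet> y"
proof -
  define E where "E = {(y, r). q y < r}"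
  define L where "L = (\<lambda>y. (y, V \<bullet> y)) ` R"
  have q0: "0 \<le> q 0"
    using V[of 0] R by (simp add: subspace_0)
  have scale': "q (c *\<^sub>R x) \<le> c * q x" if "0 \<le> c" for c x
    using that scale[of c x] scale[of 2 0] by (cases "c = 0") auto
  have "convex E"
    unfolding convex_alt
  proof (intro ballI allI impI)
    fix z w and c :: real
    assume zw: "z \<in> E" "w \<in> E" and c: "0 \<le> c \<and> c \<le> 1"
    have "q ((1 - c) *\<^sub>R fst z + c *\<^sub>R fst w) \<le> (1 - c) * q (fst z) + c * q (fst w)"
      using add[of "(1 - c) *\<^sub>R fst z" "c *\<^sub>R fst w"] scale'[of "1 - c" "fst z"] scale'[of c "fst w"] c
      by linarith
    also have "\<dots> < (1 - c) * snd z + c * snd w"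
    proof (cases "c = 0")
      case False
      then show ?thesis
        using zw c by (intro add_le_less_mono mult_left_mono mult_strict_left_mono) (auto simp: E_def)
    qed (use zw in \<open>auto simp: E_def\<close>)
    finally show "(1 - c) *\<^sub>R z + c *\<^sub>R w \<in> E"
      by (simp add: E_def case_prod_beta)
  qed
  moreover have "subspace L"
    unfolding L_def by (intro linear_subspace_image R linearI) (auto simp: inner_add_right)
  moreover have "(0, q 0 + 1) \<in> E"
    by (simp add: E_def)
  moreover have "E \<inter> L = {}"
    using V by (force simp: E_def L_def)
  ultimately obtain z b where z: "z \<noteq> 0" "\<And>x. x \<in> E \<Longrightarrow> z \<bullet> x \<le> b" "\<And>x. x \<in> L \<Longrightarrow> b \<le> z \<bullet> x"
    using separating_hyperplane_sets[of E L] subspace_imp_convex[of L] subspace_0[of L] by blast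
  obtain a \<beta> where ab: "z = (a, \<beta>)"
    by (cases z)
  \<comment> \<open>a linear functional that is bounded below on a subspace vanishes there\<close>
  have zL: "z \<bullet> x = 0" if "x \<in> L" for x
  proof (rule ccontr)
    assume ne: "z \<bullet> x \<noteq> 0"
    have "((b - 1) / (z \<bullet> x)) *\<^sub>R x \<in> L"
      using that \<open>subspace L\<close> by (simp add: subspace_scale)
    from z(3)[OF this] ne show False
      by simp
  qed
  have "b \<le> 0"
    using z(3)[of 0] \<open>subspace L\<close> by (simp add: subspace_0)
  then have E: "a \<bullet> y + \<beta> * r \<le> 0" if "q y < r" for y r
    using z(2)[of "(y, r)"] that by (simp add: E_def ab)
  have "\<beta> < 0"
  proof (rule ccontr)
    assume "\<not> \<beta> < 0"
    then consider "\<beta> > 0" | "\<beta> = 0"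
      by linarith
    then show False
    proof cases
      case 1
      have "\<beta> * (q 0 + 1) > 0"
        using 1 q0 by simp
      then show False
        using E[of 0 "q 0 + 1"] by simp
    next
      case 2
      then have "a \<bullet> a \<le> 0"
        using E[of a "q a + 1"] by simp
      then have "a = 0"
        using inner_gt_zero_iff[of a] by linarith
      then show False
        using z(1) 2 ab by (simp add: zero_prod_def)
    qed
  qed
  \<comment> \<open>the hyperplane solved for its last coordinate\<close>
  define S where "S = (1 / (- \<beta>)) *\<^sub>R a"
  have Sy: "S \<bullet> y = (a \<bullet> y) / (- \<beta>)" for y
    by (simp add: S_def)
  show ?thesis
  proof (rule that)
    show "S \<bullet> y \<le> q y" for y
    proof (rule dense_ge)
      fix r assume "q y < r"
      from E[OF this] have "a \<bullet> y \<le> r * (- \<beta>)"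
        by (simp add: mult.commute)
      then show "S \<bullet> y \<le> r"
        unfolding Sy using \<open>\<beta> < 0\<close> by (subst pos_divide_le_eq) auto
    qed
    show "S \<bullet> y = V \<bullet> y" if "y \<in> R" for y
    proof -
      have "a \<bullet> y + \<beta> * (V \<bullet> y) = 0"
        using zL[of "(y, V \<bullet> y)"] that by (simp add: L_def ab)
      then have "a \<bullet> y = (V \<bullet> y) * (- \<beta>)"
        by (simp add: mult.commute)
      then show ?thesis
        unfolding Sy using \<open>\<beta> < 0\<close> by simp
    qed
  qed
qed

text \<open>
  Subgradients of \<open>\<theta>\<close> at \<open>X\<close> are the linear functionals below the directional derivative, because
  the difference quotient at \<open>t = 1\<close> is at least the limit.
\<close>

lemma subdifferential_iff_dir_deriv:
  fixes \<theta> :: "'b::real_inner \<Rightarrow> real"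
  assumes cv: "convex_on UNIV \<theta>"
  shows "S \<in> subdifferential \<theta> X \<longleftrightarrow> (\<forall>H. S \<bullet> H \<le> dir_deriv \<theta> X H)"
proof
  assume S: "S \<in> subdifferential \<theta> X"
  show "\<forall>H. S \<bullet> H \<le> dir_deriv \<theta> X H"
  proof (intro allI le_dir_derivI[OF cv])
    fix H and t :: real assume "0 < t"
    moreover have "\<theta> X + S \<bullet> (t *\<^sub>R H) \<le> \<theta> (X + t *\<^sub>R H)"
      using S unfolding subdifferential_def by (metis (mono_tags, lifting) add_diff_cancel_left' mem_Collect_eq)
    ultimately show "S \<bullet> H \<le> (\<theta> (X + t *\<^sub>R H) - \<theta> X) / t"
      by (simp add: field_simps)
  qed
next
  assume S: "\<forall>H. S \<bullet> H \<le> dir_deriv \<theta> X H"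
  have "\<theta> X + S \<bullet> (Z - X) \<le> \<theta> Z" for Z
    using S[rule_format, of "Z - X"] dir_deriv_tendsto(2)[OF cv, of 1 X "Z - X"] by simp
  then show "S \<in> subdifferential \<theta> X"
    by (simp add: subdifferential_def)
qed

lemma subgradient_extending_functional:
  fixes \<theta> :: "'b::euclidean_space \<Rightarrow> real"
  assumes cv: "convex_on UNIV \<theta>" and R: "subspace R"
    and V: "\<And>H. H \<in> R \<Longrightarrow> V \<bullet> H \<le> dir_deriv \<theta> X H"
  shows "\<exists>S\<in>subdifferential \<theta> X. \<forall>H\<in>R. S \<bullet> H = V \<bullet> H"
proof -
  obtain S where "\<And>H. S \<bullet> H \<le> dir_deriv \<theta> X H" "\<And>H. H \<in> R \<Longrightarrow> S \<bullet> H = V \<bullet> H"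
    by (rule sublinear_dominated_extension[OF dir_deriv_add_le[OF cv] dir_deriv_scale[OF cv] R V]) auto
  moreover from this have "S \<in> subdifferential \<theta> X"
    by (simp add: subdifferential_iff_dir_deriv[OF cv])
  ultimately show ?thesis
    by blast
qed

text \<open>
  Extend the functional that agrees with the directional derivative on \<open>H\<close>.  It is dominated on
  the line through \<open>H\<close> because $\theta'(X; H) + \theta'(X; -H) \ge 0$.
\<close>

lemma dir_deriv_attained:
  fixes \<theta> :: "'b::euclidean_space \<Rightarrow> real"
  assumes cv: "convex_on UNIV \<theta>"
  obtains S where "S \<in> subdifferential \<theta> X" "S \<bullet> H = dir_deriv \<theta> X H"
proof -
  define V where "V = (dir_deriv \<theta> X H / (H \<bullet> H)) *\<^sub>R H"
  have VH: "V \<bullet> H = dir_deriv \<theta> X H"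
    by (cases "H = 0") (auto simp: V_def)
  have "V \<bullet> Y \<le> dir_deriv \<theta> X Y" if "Y \<in> span {H}" for Y
  proof -
    from that obtain c where Y: "Y = c *\<^sub>R H"
      by (auto simp: span_singleton)
    consider "c = 0" | "c > 0" | "c < 0"
      by linarith
    then show ?thesis
    proof cases
      case 3
      have "0 \<le> dir_deriv \<theta> X H + dir_deriv \<theta> X (- H)"
        using dir_deriv_add_le[OF cv, of X H "- H"] by simp
      then have "(- c) * (- dir_deriv \<theta> X H) \<le> (- c) * dir_deriv \<theta> X (- H)"
        using 3 by (intro mult_left_mono) auto
      then show ?thesis
        using dir_deriv_scale[OF cv, of "- c" X "- H"] 3 by (simp add: Y VH)
    qed (auto simp: Y VH dir_deriv_scale[OF cv])
  qed
  from subgradient_extending_functional[OF cv subspace_span this]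
  obtain S where "S \<in> subdifferential \<theta> X" "\<forall>Y\<in>span {H}. S \<bullet> Y = V \<bullet> Y"
    by blast
  then show ?thesis
    using that VH by (simp add: span_base)
qed

text \<open>
  If the directional derivative is odd at \<open>H\<close>, each subgradient is squeezed between
  $-\theta'(X; -H)$ and $\theta'(X; H)$.  Conversely both bounds are attained by subgradients, so
  they agree if all subgradients do.
\<close>

lemma T_lin_iff:
  fixes \<theta> :: "'b::euclidean_space \<Rightarrow> real"
  assumes cv: "convex_on UNIV \<theta>"
  shows "H \<in> T_lin \<theta> X \<longleftrightarrow>
    (\<forall>S\<in>subdifferential \<theta> X. \<forall>S'\<in>subdifferential \<theta> X. S \<bullet> H = S' \<bullet> H)"
proof
  assume H: "H \<in> T_lin \<theta> X"
  have "S \<bullet> H = dir_deriv \<theta> X H" if "S \<in> subdifferential \<theta> X" for S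
  proof -
    have "S \<bullet> H \<le> dir_deriv \<theta> X H" "S \<bullet> (- H) \<le> dir_deriv \<theta> X (- H)"
      using that unfolding subdifferential_iff_dir_deriv[OF cv] by blast+
    then show ?thesis
      using H by (simp add: T_lin_def)
  qed
  then show "\<forall>S\<in>subdifferential \<theta> X. \<forall>S'\<in>subdifferential \<theta> X. S \<bullet> H = S' \<bullet> H"
    by simp
next
  assume const: "\<forall>S\<in>subdifferential \<theta> X. \<forall>S'\<in>subdifferential \<theta> X. S \<bullet> H = S' \<bullet> H"
  obtain S where S: "S \<in> subdifferential \<theta> X" "S \<bullet> H = dir_deriv \<theta> X H"
    by (rule dir_deriv_attained[OF cv])
  obtain S' where S': "S' \<in> subdifferential \<theta> X" "S' \<bullet> (- H) = dir_deriv \<theta> X (- H)"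
    by (rule dir_deriv_attained[OF cv])
  have "S \<bullet> H = S' \<bullet> H"
    using const S(1) S'(1) by blast
  then show "H \<in> T_lin \<theta> X"
    using S(2) S'(2) by (simp add: T_lin_def)
qed

section \<open>Multipliers of a composite minimization problem\<close>

lemma has_derivative_imp_dir_quotient_tendsto:
  assumes "(f has_derivative f') (at x)"
  shows "((\<lambda>t. (f (x + t *\<^sub>R h) - f x) /\<^sub>R t) \<longlongrightarrow> f' h) (at_right 0)"
proof -
  interpret f': bounded_linear f'
    using assms by (rule has_derivative_bounded_linear)
  have "((\<lambda>t. x + t *\<^sub>R h) has_derivative (\<lambda>t. t *\<^sub>R h)) (at 0)"
    by (auto intro!: derivative_eq_intros)
  then have "((\<lambda>t. f (x + t *\<^sub>R h)) has_derivative (\<lambda>t. f' (t *\<^sub>R h))) (at 0)"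
    using has_derivative_compose[of "\<lambda>t. x + t *\<^sub>R h" "\<lambda>t. t *\<^sub>R h" 0 UNIV f f'] assms by simp
  then have "((\<lambda>t. norm (f (x + t *\<^sub>R h) - f x - f' (t *\<^sub>R h)) / norm t) \<longlongrightarrow> 0) (at 0)"
    unfolding has_derivative_at by simp
  then have "((\<lambda>t. norm (f (x + t *\<^sub>R h) - f x - f' (t *\<^sub>R h)) / norm t) \<longlongrightarrow> 0) (at_right 0)"
    by (rule tendsto_within_subset) simp
  moreover have "\<forall>\<^sub>F t in at_right 0. norm (f (x + t *\<^sub>R h) - f x - f' (t *\<^sub>R h)) / norm t
      = norm ((f (x + t *\<^sub>R h) - f x) /\<^sub>R t - f' h)"
    using eventually_at_right_less[of "0::real"]
  proof (rule eventually_mono)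
    fix t :: real assume t: "0 < t"
    have "(f (x + t *\<^sub>R h) - f x) /\<^sub>R t - f' h = (f (x + t *\<^sub>R h) - f x - f' (t *\<^sub>R h)) /\<^sub>R t"
      using t by (simp add: f'.scaleR scaleR_diff_right)
    then show "norm (f (x + t *\<^sub>R h) - f x - f' (t *\<^sub>R h)) / norm t
      = norm ((f (x + t *\<^sub>R h) - f x) /\<^sub>R t - f' h)"
      using t by (simp add: divide_inverse)
  qed
  ultimately have "((\<lambda>t. norm ((f (x + t *\<^sub>R h) - f x) /\<^sub>R t - f' h)) \<longlongrightarrow> 0) (at_right 0)"
    by (rule Lim_transform_eventually)
  then show ?thesis
    by (rule LIM_zero_cancel[OF tendsto_norm_zero_cancel])
qed

text \<open>
  The directional derivative is taken along \<open>G h\<close>, while the curve moves along difference quotients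
  \<open>w t\<close> of \<open>g\<close> that only converge to \<open>G h\<close>.  Monotonicity replaces the step \<open>t\<close> in direction \<open>w t\<close>
  by a fixed larger step \<open>s\<close>; then continuity of \<open>\<theta>\<close> permits \<open>t\<close> to tend to zero, and \<open>s\<close> is arbitrary.
\<close>

lemma local_minimizer_dir_deriv_nonneg:
  fixes \<theta> :: "'b::euclidean_space \<Rightarrow> real" and g :: "'a::real_normed_vector \<Rightarrow> 'b"
  assumes cv: "convex_on UNIV \<theta>"
    and f: "(f has_derivative f') (at x)" and g: "(g has_derivative G) (at x)"
    and opt: "local_minimizer (\<lambda>y. f y + \<theta> (g y)) x"
  shows "0 \<le> f' h + dir_deriv \<theta> (g x) (G h)"
proof -
  have cont: "isCont \<theta> Y" for Y
    using convex_on_continuous[OF open_UNIV cv] continuous_on_eq_continuous_at by blast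
  define w where "w t = (g (x + t *\<^sub>R h) - g x) /\<^sub>R t" for t
  have w: "(w \<longlongrightarrow> G h) (at_right 0)"
    unfolding w_def by (rule has_derivative_imp_dir_quotient_tendsto[OF g])
  have gx: "g (x + t *\<^sub>R h) = g x + t *\<^sub>R w t" if "0 < t" for t
    using that by (simp add: w_def)
  have "((\<lambda>t. x + t *\<^sub>R h) \<longlongrightarrow> x + 0 *\<^sub>R h) (at_right 0)"
    by (intro tendsto_intros)
  then have "filterlim (\<lambda>t. x + t *\<^sub>R h) (nhds x) (at_right 0)"
    by simp
  then have near: "\<forall>\<^sub>F t in at_right 0. f x + \<theta> (g x) \<le> f (x + t *\<^sub>R h) + \<theta> (g (x + t *\<^sub>R h))"
    using opt by (auto simp: local_minimizer_def filterlim_iff)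
  have "- f' h \<le> dir_deriv \<theta> (g x) (G h)"
  proof (rule le_dir_derivI[OF cv])
    fix s :: real assume s: "0 < s"
    have "0 \<le> f' h + (\<theta> (g x + s *\<^sub>R G h) - \<theta> (g x)) / s"
    proof (rule tendsto_lowerbound)
      show "((\<lambda>t. (f (x + t *\<^sub>R h) - f x) /\<^sub>R t + (\<theta> (g x + s *\<^sub>R w t) - \<theta> (g x)) / s)
          \<longlongrightarrow> f' h + (\<theta> (g x + s *\<^sub>R G h) - \<theta> (g x)) / s) (at_right 0)"
        using s by (intro tendsto_intros has_derivative_imp_dir_quotient_tendsto f w
            isCont_tendsto_compose[OF cont]) auto
      have "\<forall>\<^sub>F t in at_right 0. 0 < t \<and> t < s"
        using s by (simp add: eventually_at_right_field) metis
      with near show "\<forall>\<^sub>F t in at_right 0.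
          0 \<le> (f (x + t *\<^sub>R h) - f x) /\<^sub>R t + (\<theta> (g x + s *\<^sub>R w t) - \<theta> (g x)) / s"
      proof eventually_elim
        case (elim t)
        then have "0 \<le> (f (x + t *\<^sub>R h) - f x + (\<theta> (g x + t *\<^sub>R w t) - \<theta> (g x))) / t"
          using gx[of t] by (intro divide_nonneg_pos) auto
        also have "\<dots> = (f (x + t *\<^sub>R h) - f x) /\<^sub>R t + (\<theta> (g x + t *\<^sub>R w t) - \<theta> (g x)) / t"
          by (simp add: divide_inverse mult.commute distrib_left)
        also have "(\<theta> (g x + t *\<^sub>R w t) - \<theta> (g x)) / t \<le> (\<theta> (g x + s *\<^sub>R w t) - \<theta> (g x)) / s"
          using elim by (intro diff_quotient_mono[OF cv]) auto
        finally show ?case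
          by simp
      qed
    qed simp
    then show "- f' h \<le> (\<theta> (g x + s *\<^sub>R G h) - \<theta> (g x)) / s"
      by simp
  qed
  then show ?thesis
    by simp
qed

text \<open>
  On the kernel of \<open>G\<close> the functional \<open>f'\<close> is nonnegative, hence zero.  So \<open>- f'\<close> is a linear
  functional of \<open>G h\<close>, dominated on the range of \<open>G\<close> by the directional derivative of \<open>\<theta>\<close>, and a
  dominated extension is the multiplier.
\<close>

lemma subgradient_multiplier_exists:
  fixes \<theta> :: "'b::euclidean_space \<Rightarrow> real" and g :: "'a::real_normed_vector \<Rightarrow> 'b"
  assumes cv: "convex_on UNIV \<theta>"
    and f: "(f has_derivative f') (at x)" and g: "(g has_derivative G) (at x)"
    and opt: "local_minimizer (\<lambda>y. f y + \<theta> (g y)) x"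
  obtains S where "S \<in> subdifferential \<theta> (g x)" "\<And>h. f' h + G h \<bullet> S = 0"
proof -
  note nonneg = local_minimizer_dir_deriv_nonneg[OF cv f g opt]
  have lf: "linear f'" and lG: "linear G"
    using f g by (auto intro: has_derivative_linear)
  \<comment> \<open>a linear section of G over its range\<close>
  obtain r where r: "linear r" "\<And>h. G (r (G h)) = G h"
    using linear_exists_right_inverse_on[OF lG subspace_UNIV] by auto
  have factor: "f' (r (G h)) = f' h" for h
  proof -
    let ?k = "r (G h) - h"
    have "G ?k = 0" "G (- ?k) = 0"
      using r(2) lG by (simp_all add: linear_diff)
    then have "0 \<le> f' ?k" "0 \<le> f' (- ?k)"
      using nonneg[of ?k] nonneg[of "- ?k"] by simp_all
    then show ?thesis
      using lf by (simp add: linear_diff)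
  qed
  define V where "V = adjoint (\<lambda>y. - f' (r y)) 1"
  have "linear (\<lambda>y. - f' (r y))"
    using linear_compose[OF r(1) lf] by (simp add: linear_compose_neg comp_def)
  then have V: "V \<bullet> y = - f' (r y)" for y
    unfolding V_def using adjoint_works[of "\<lambda>y. - f' (r y)" y 1] by (simp add: inner_commute)
  have sub: "subspace (range G)"
    using lG by (simp add: linear_subspace_image)
  have "V \<bullet> H \<le> dir_deriv \<theta> (g x) H" if "H \<in> range G" for H
  proof -
    from that obtain h where "H = G h"
      by blast
    then show ?thesis
      using nonneg[of h] by (simp add: V factor)
  qed
  from subgradient_extending_functional[OF cv sub this]
  obtain S where S: "S \<in> subdifferential \<theta> (g x)" "\<forall>H\<in>range G. S \<bullet> H = V \<bullet> H" ..
  have "f' h + G h \<bullet> S = 0" for h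
    using S(2) by (simp add: V factor inner_commute[of "G h"])
  with S(1) show ?thesis
    by (rule that)
qed

lemma nondegenerate_iff:
  assumes "(g has_derivative G) (at x)"
  shows "nondegenerate \<theta> g x \<longleftrightarrow> {U + H |U H. U \<in> range G \<and> H \<in> T_lin \<theta> (g x)} = UNIV"
  unfolding nondegenerate_def frechet_derivative_at[OF assms, symmetric] ..

text \<open>
  The difference \<open>S - S'\<close> is orthogonal to the range of \<open>G\<close> and to \<open>T_lin\<close>, hence to itself.
\<close>

lemma nondegenerate_imp_multiplier_unique:
  fixes \<theta> :: "'b::euclidean_space \<Rightarrow> real" and g :: "'a::real_normed_vector \<Rightarrow> 'b"
  assumes cv: "convex_on UNIV \<theta>" and g: "(g has_derivative G) (at x)"
    and nd: "nondegenerate \<theta> g x"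
    and S: "S \<in> subdifferential \<theta> (g x)" "\<And>h. f' h + G h \<bullet> S = 0"
    and S': "S' \<in> subdifferential \<theta> (g x)" "\<And>h. f' h + G h \<bullet> S' = 0"
  shows "S = S'"
proof -
  have "S - S' \<in> {U + H |U H. U \<in> range G \<and> H \<in> T_lin \<theta> (g x)}"
    unfolding nondegenerate_iff[OF g, THEN iffD1, OF nd] by (rule UNIV_I)
  then obtain h H where D: "S - S' = G h + H" and H: "H \<in> T_lin \<theta> (g x)"
    by blast
  have "G h \<bullet> (S - S') = 0"
    using S(2)[of h] S'(2)[of h] by (simp add: inner_diff_right)
  moreover have "H \<bullet> (S - S') = 0"
  proof -
    have "S \<bullet> H = S' \<bullet> H"
      using H S(1) S'(1) unfolding T_lin_iff[OF cv] by blast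
    then show ?thesis
      by (simp add: inner_diff_right inner_commute[of H])
  qed
  ultimately have "(G h + H) \<bullet> (S - S') = 0"
    by (simp add: inner_add_left)
  then show ?thesis
    unfolding D[symmetric] by simp
qed

text \<open>
  \<open>T_lin\<close> is the orthogonal complement of the direction space \<open>L\<close> of the affine hull of the
  subdifferential.  A vector \<open>W\<close> orthogonal to \<open>T_lin\<close> therefore lies in \<open>L\<close>, and the relative
  interior leaves room to move \<open>S\<close> along \<open>W\<close>.
\<close>

lemma unique_multiplier_imp_nondegenerate:
  fixes \<theta> :: "'b::euclidean_space \<Rightarrow> real" and g :: "'a::real_normed_vector \<Rightarrow> 'b"
  assumes cv: "convex_on UNIV \<theta>" and g: "(g has_derivative G) (at x)"
    and S: "S \<in> rel_interior (subdifferential \<theta> (g x))" "\<And>h. f' h + G h \<bullet> S = 0"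
    and uniq: "\<And>S'. S' \<in> subdifferential \<theta> (g x) \<Longrightarrow> (\<And>h. f' h + G h \<bullet> S' = 0) \<Longrightarrow> S' = S"
  shows "nondegenerate \<theta> g x"
proof (rule ccontr)
  let ?D = "subdifferential \<theta> (g x)" and ?T = "T_lin \<theta> (g x)"
  let ?N = "{U + H |U H. U \<in> range G \<and> H \<in> ?T}"
  assume "\<not> nondegenerate \<theta> g x"
  then have "?N \<noteq> UNIV"
    unfolding nondegenerate_iff[OF g] .
  obtain e where S_mem: "S \<in> ?D" and e: "0 < e" "cball S e \<inter> affine hull ?D \<subseteq> ?D"
    using S(1) unfolding mem_rel_interior_cball by blast
  define L where "L = span ((\<lambda>Y. - S + Y) ` ?D)"
  have T: "?T = L\<^sup>\<bottom>"
  proof (rule set_eqI)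
    fix H
    have "H \<in> L\<^sup>\<bottom> \<longleftrightarrow> (\<forall>Y\<in>?D. (- S + Y) \<bullet> H = 0)"
    proof
      assume "H \<in> L\<^sup>\<bottom>"
      then show "\<forall>Y\<in>?D. (- S + Y) \<bullet> H = 0"
        by (simp add: L_def orthogonal_comp_def orthogonal_def span_base)
    next
      assume "\<forall>Y\<in>?D. (- S + Y) \<bullet> H = 0"
      then have "(\<lambda>Y. - S + Y) ` ?D \<subseteq> {y. orthogonal H y}"
        by (auto simp: orthogonal_def inner_commute[of H])
      then have "L \<subseteq> {y. orthogonal H y}"
        unfolding L_def by (rule span_minimal) (rule subspace_orthogonal_to_vector)
      then show "H \<in> L\<^sup>\<bottom>"
        by (auto simp: orthogonal_comp_def orthogonal_commute)
    qed
    also have "\<dots> \<longleftrightarrow> (\<forall>Y\<in>?D. Y \<bullet> H = S \<bullet> H)"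
      by (simp add: inner_diff_left)
    also have "\<dots> \<longleftrightarrow> H \<in> ?T"
      unfolding T_lin_iff[OF cv] using S_mem by metis
    finally show "H \<in> ?T \<longleftrightarrow> H \<in> L\<^sup>\<bottom>" ..
  qed
  have subT: "subspace ?T"
    unfolding T by (rule subspace_orthogonal_comp)
  have subG: "subspace (range G)"
    using has_derivative_linear[OF g] by (simp add: linear_subspace_image)
  have "subspace ?N"
    using subspace_sums[OF subG subT] .
  then have "span ?N = ?N"
    unfolding span_eq_iff .
  with \<open>?N \<noteq> UNIV\<close> obtain W where W: "W \<noteq> 0" "\<forall>y\<in>?N. W \<bullet> y = 0"
    using span_not_UNIV_orthogonal[of ?N] unfolding \<open>span ?N = ?N\<close> by blast
  have WG: "W \<bullet> G h = 0" for h
  proof -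
    have "G h + 0 \<in> ?N"
      using subspace_0[OF subT] by blast
    then have "W \<bullet> (G h + 0) = 0"
      by (rule W(2)[rule_format])
    then show ?thesis
      by simp
  qed
  have "W \<bullet> H = 0" if "H \<in> ?T" for H
  proof -
    have "0 + H \<in> ?N"
      using subspace_0[OF subG] that by blast
    then have "W \<bullet> (0 + H) = 0"
      by (rule W(2)[rule_format])
    then show ?thesis
      by simp
  qed
  \<comment> \<open>a subspace of a Euclidean space is its own double orthogonal complement\<close>
  then have "W \<in> L\<^sup>\<bottom>\<^sup>\<bottom>"
    unfolding T by (simp add: orthogonal_comp_def orthogonal_def inner_commute)
  then have "W \<in> L"
    by (simp add: orthogonal_comp_self L_def)
  define S' where "S' = S + (e / norm W) *\<^sub>R W"
  have "S' \<in> affine hull ?D"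
    using affine_hull_span_gen[OF hull_inc[OF S_mem]] \<open>W \<in> L\<close>
    by (auto simp: S'_def L_def span_scale)
  moreover have "S' \<in> cball S e"
    using e(1) W(1) by (simp add: S'_def dist_norm)
  ultimately have "S' \<in> ?D"
    using e(2) by blast
  moreover have "f' h + G h \<bullet> S' = 0" for h
    using S(2)[of h] WG[of h] by (simp add: S'_def inner_add_right inner_commute[of "G h" W])
  ultimately have "S' = S"
    by (rule uniq)
  then show False
    using e(1) W(1) by (simp add: S'_def)
qed

section \<open>Gradients and adjoints on a finite-dimensional inner product space\<close>

text \<open>
  The type \<open>'a\<close> carries no fixed orthonormal basis, so the representing vector is built from an
  orthogonal spanning set.  That set may contain zero, whose term vanishes since \<open>x / 0 = 0\<close>.
\<close>

lemma riesz_representation_finite_span: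
  fixes \<phi> :: "'a::real_inner \<Rightarrow> real"
  assumes fd: "\<exists>B::'a set. finite B \<and> span B = UNIV" and "linear \<phi>"
  obtains D where "\<And>x. \<phi> x = x \<bullet> D"
proof -
  obtain B :: "'a set" where B: "finite B" "span B = UNIV"
    using fd by blast
  obtain C :: "'a set" where C: "finite C" "span C = UNIV" "pairwise orthogonal C"
    using basis_orthogonal[OF B(1)] B(2) by auto
  define D where "D = (\<Sum>c\<in>C. (\<phi> c / (c \<bullet> c)) *\<^sub>R c)"
  have "\<phi> c = c \<bullet> D" if "c \<in> C" for c
  proof -
    have "c \<bullet> D = (\<Sum>d\<in>C. (\<phi> d / (d \<bullet> d)) * (c \<bullet> d))"
      by (simp add: D_def inner_sum_right)
    also have "\<dots> = (\<Sum>d\<in>C. if d = c then \<phi> c else 0)"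
      using C(3) that linear_0[OF \<open>linear \<phi>\<close>]
      by (intro sum.cong) (auto simp: pairwise_def orthogonal_def)
    finally show ?thesis
      using that C(1) by simp
  qed
  then have "\<phi> x = x \<bullet> D" for x
    using linear_eq_on_span[of \<phi> "\<lambda>x. x \<bullet> D" C x] \<open>linear \<phi>\<close> C(2)
    by (simp add: linear_iff inner_add_left)
  then show ?thesis
    by (rule that)
qed

lemma inner_gradient:
  fixes f :: "'a::real_inner \<Rightarrow> real"
  assumes fd: "\<exists>B::'a set. finite B \<and> span B = UNIV" and f: "(f has_derivative f') (at x)"
  shows "h \<bullet> gradient f x = f' h"
proof -
  obtain D where D: "\<And>h. f' h = h \<bullet> D"
    using riesz_representation_finite_span[OF fd has_derivative_linear[OF f]] by blast
  have "gradient f x = D"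
    unfolding gradient_def
  proof (rule the_equality)
    show "GDERIV f x :> D"
      using f ext[of f' "\<lambda>h. h \<bullet> D", OF D] by (simp add: gderiv_def)
    fix D' assume "GDERIV f x :> D'"
    then have "f' = (\<lambda>h. h \<bullet> D')"
      unfolding gderiv_def using f has_derivative_unique by blast
    then have "h \<bullet> (D' - D) = 0" for h
      using D[of h] by (simp add: inner_diff_right)
    then show "D' = D"
      by (metis inner_eq_zero_iff right_minus_eq)
  qed
  then show ?thesis
    by (simp add: D)
qed

text \<open>
  \<open>adjoint\<close> is defined by choice, so its defining property needs some adjoint to exist; the
  Riesz representation provides one.
\<close>

lemma inner_adjoint_finite_span:
  fixes G :: "'a::real_inner \<Rightarrow> 'b::real_inner"
  assumes fd: "\<exists>B::'a set. finite B \<and> span B = UNIV" and G: "linear G"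
  shows "h \<bullet> adjoint G S = G h \<bullet> S"
proof -
  have "\<exists>D. \<forall>h. G h \<bullet> S = h \<bullet> D" for S
  proof -
    have "linear (\<lambda>h. G h \<bullet> S)"
      using G by (simp add: linear_iff inner_add_left)
    then show ?thesis
      using riesz_representation_finite_span[OF fd] by metis
  qed
  then obtain A where "\<forall>S h. G h \<bullet> S = h \<bullet> A S"
    by metis
  then have "\<forall>h S. G h \<bullet> S = h \<bullet> A S"
    by blast
  then have "\<forall>h S. G h \<bullet> S = h \<bullet> adjoint G S"
    unfolding adjoint_def by (rule someI[of "\<lambda>A. \<forall>h S. G h \<bullet> S = h \<bullet> A S" A])
  then show ?thesis
    by simp
qed

text \<open>
  The form of stationarity without gradient and adjoint, in which the multiplier lemmas are stated.
\<close>

lemma stationarity_iff: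
  fixes f :: "'a::real_inner \<Rightarrow> real" and g :: "'a \<Rightarrow> 'b::real_inner"
  assumes fd: "\<exists>B::'a set. finite B \<and> span B = UNIV"
    and f: "(f has_derivative f') (at x)" and g: "(g has_derivative G) (at x)"
  shows "stationarity f g x S \<longleftrightarrow> (\<forall>h. f' h + G h \<bullet> S = 0)"
proof -
  have "stationarity f g x S \<longleftrightarrow> (\<forall>h. h \<bullet> (gradient f x + adjoint G S) = 0)"
    unfolding stationarity_def frechet_derivative_at[OF g, symmetric]
    by (metis inner_eq_zero_iff inner_zero_right)
  then show ?thesis
    by (simp add: inner_add_right inner_gradient[OF fd f]
        inner_adjoint_finite_span[OF fd has_derivative_linear[OF g]])
qed

theorem proposition4p5:
  fixes f :: "'a::real_inner \<Rightarrow> real"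
    and g :: "'a \<Rightarrow> real^'n^'m"
    and k :: nat
    and xbar :: 'a
  assumes finite_dim: "\<exists>B::'a set. finite B \<and> span B = UNIV"
    and f_C1: "continuously_differentiable f"
    and g_C1: "continuously_differentiable g"
    and k_ge: "1 \<le> k" and k_le: "k \<le> CARD('m)" and m_le_n: "CARD('m) \<le> CARD('n)"
    and opt: "local_minimizer (\<lambda>x. f x + ky_fan_norm k (g x)) xbar"
  shows "(nondegenerate (ky_fan_norm k) g xbar \<longrightarrow>
            (\<exists>!S. stationarity f g xbar S \<and> S \<in> subdifferential (ky_fan_norm k) (g xbar)))
       \<and> ((\<exists>!S. stationarity f g xbar S \<and> S \<in> subdifferential (ky_fan_norm k) (g xbar)) \<and>
          strict_complementarity (ky_fan_norm k) f g xbar \<longrightarrow>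
            nondegenerate (ky_fan_norm k) g xbar)"
proof -
  obtain f' where f: "(f has_derivative f') (at xbar)"
    using f_C1 unfolding continuously_differentiable_def by blast
  obtain G where g: "(g has_derivative G) (at xbar)"
    using g_C1 unfolding continuously_differentiable_def by blast
  have cv: "convex_on UNIV (ky_fan_norm k :: real^'n^'m \<Rightarrow> real)"
    by (rule convex_on_ky_fan_norm[OF k_ge k_le])
  note stat = stationarity_iff[OF finite_dim f g]
  show ?thesis
  proof (intro conjI impI)
    assume nd: "nondegenerate (ky_fan_norm k) g xbar"
    obtain S where "S \<in> subdifferential (ky_fan_norm k) (g xbar)" "\<And>h. f' h + G h \<bullet> S = 0"
      by (rule subgradient_multiplier_exists[OF cv f g opt]) blast
    then show "\<exists>!S. stationarity f g xbar S \<and> S \<in> subdifferential (ky_fan_norm k) (g xbar)"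
      unfolding stat using nondegenerate_imp_multiplier_unique[OF cv g nd, where f' = f'] by blast
  next
    assume *: "(\<exists>!S. stationarity f g xbar S \<and> S \<in> subdifferential (ky_fan_norm k) (g xbar)) \<and>
      strict_complementarity (ky_fan_norm k) f g xbar"
    then obtain S where S: "S \<in> rel_interior (subdifferential (ky_fan_norm k) (g xbar))"
      "stationarity f g xbar S"
      unfolding strict_complementarity_def by blast
    have "S \<in> subdifferential (ky_fan_norm k) (g xbar)"
      using S(1) rel_interior_subset by blast
    with * S(2) have uniq: "S' = S"
      if "stationarity f g xbar S'" "S' \<in> subdifferential (ky_fan_norm k) (g xbar)" for S'
      using that by blast
    show "nondegenerate (ky_fan_norm k) g xbar"
      by (rule unique_multiplier_imp_nondegenerate[OF cv g S(1), where f' = f'])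
        (use S(2) uniq in \<open>auto simp: stat\<close>)
  qed
qed

end
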